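(* For $\rho\in\mathbb{R}$ let $A_n(\rho)\in\mathbb{R}^{n\times n}$ be the Kac--Murdock--Szeg\"o matrix, with entries $(A_n(\rho))_{ij}=\rho^{|i-j|}$ (with $\rho^0=1$). Let $T_n(-\rho)$ be the $n\times n$ upper bidiagonal matrix with ones on the diagonal and $-\rho$ in every superdiagonal position. Then $A_n(\rho)=LDL^T$ with $$L=T_n(-\rho)^{-T},\qquad D=\operatorname{diag}(1,1-\rho^2,1-\rho^2,\dots,1-\rho^2),$$ and the following hold. (1) $\det(A_n(\rho))=(1-\rho^2)^{n-1}$. (2) For $\rho\ne\pm1$, $A_n(\rho)$ is nonsingular and $A_n(\rho)^{-1}=T_n(-\rho)D^{-1}T_n(-\rho)^T$; for $n\ge2$ this is the tridiagonal matrix equal to $\frac{1}{1-\rho^2}$ times the symmetric tridiagonal matrix whose diagonal is $(1,1+\rho^2,\dots,1+\rho^2,1)$ and whose superdiagonal and subdiagonal entries all equal $-\rho$. (3) For $0\le\rho\le1$, $A_n(\rho)$ is totally nonnegative; and for every $\rho\in(-1,1)$ with $\rho\ne0$, $A_n(\rho)$ has distinct eigenvalues.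
   Context: A matrix $A\in\mathbb{R}^{n\times n}$ is totally nonnegative if every minor (determinant of a square submatrix) is nonnegative. $X^{-T}$ denotes $(X^{-1})^T$. *)

theory Defs
  imports
    Complex_Main
    "Jordan_Normal_Form.Gauss_Jordan_Elimination"
    "Jordan_Normal_Form.Char_Poly"
    "Jordan_Normal_Form.DL_Submatrix"
begin

(* All matrices are indexed from 0, as usual for the type 'a mat. *)

definition kms_mat :: "nat \<Rightarrow> real \<Rightarrow> real mat" where
  "kms_mat n \<rho> = mat n n (\<lambda>(i, j). \<rho> ^ nat \<bar>int i - int j\<bar>)"

definition bidiag_mat :: "nat \<Rightarrow> real \<Rightarrow> real mat" where
  "bidiag_mat n c = mat n n (\<lambda>(i, j). if j = i then 1 else if j = Suc i then c else 0)"

definition kms_D :: "nat \<Rightarrow> real \<Rightarrow> real mat" where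
  "kms_D n \<rho> = mat_diag n (\<lambda>i. if i = 0 then 1 else 1 - \<rho>\<^sup>2)"

(* The library's mat_inverse returns an option; the value of mat_inv is
   unspecified unless the argument is invertible. *)
definition mat_inv :: "'a :: field mat \<Rightarrow> 'a mat" where
  "mat_inv A = the (mat_inverse A)"

lemma mat_inv_invertible:
  fixes A :: "'a :: field mat"
  assumes A: "A \<in> carrier_mat n n" and inv: "invertible_mat A"
  shows "mat_inv A \<in> carrier_mat n n" "A * mat_inv A = 1\<^sub>m n" "mat_inv A * A = 1\<^sub>m n"
proof -
  from inv obtain B where B: "inverts_mat A B" "inverts_mat B A"
    unfolding invertible_mat_def by blast
  from B A have AB: "A * B = 1\<^sub>m n" and BA: "B * A = 1\<^sub>m (dim_row B)"
    unfolding inverts_mat_def by auto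
  have "dim_col B = n" using arg_cong[OF AB, of dim_col] by simp
  moreover have "dim_row B = n" using arg_cong[OF BA, of dim_col] A by simp
  ultimately have "A \<in> Units (ring_mat TYPE('a) n ())"
    using A AB BA unfolding Units_def ring_mat_def by auto
  then obtain C where C: "mat_inverse A = Some C"
    using mat_inverse(1)[OF A] by (meson not_None_eq)
  from mat_inverse(2)[OF A C] C
  show "mat_inv A \<in> carrier_mat n n" "A * mat_inv A = 1\<^sub>m n" "mat_inv A * A = 1\<^sub>m n"
    by (simp_all add: mat_inv_def)
qed

definition kms_L :: "nat \<Rightarrow> real \<Rightarrow> real mat" where
  "kms_L n \<rho> = transpose_mat (mat_inv (bidiag_mat n (- \<rho>)))"

definition kms_tridiag :: "nat \<Rightarrow> real \<Rightarrow> real mat" where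
  "kms_tridiag n \<rho> = mat n n (\<lambda>(i, j).
     if i = j then (if i = 0 \<or> i = n - 1 then 1 else 1 + \<rho>\<^sup>2)
     else if j = Suc i \<or> i = Suc j then - \<rho>
     else 0)"

(* I and J select the rows and columns of a square submatrix; the empty minor is 1. *)
definition totally_nonneg :: "real mat \<Rightarrow> bool" where
  "totally_nonneg A \<longleftrightarrow>
     (\<forall>I J. I \<subseteq> {..<dim_row A} \<longrightarrow> J \<subseteq> {..<dim_col A} \<longrightarrow> card I = card J \<longrightarrow>
        0 \<le> det (submatrix A I J))"

(* An n x n matrix has n eigenvalues counted with multiplicity (over the algebraic
   closure), so they are pairwise distinct exactly if there are n different ones.
   For a real A the set ranges over the real eigenvalues, so that the property also
   says that all eigenvalues are real; this is automatic for symmetric matrices. *)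
definition has_distinct_eigenvalues :: "'a :: field mat \<Rightarrow> bool" where
  "has_distinct_eigenvalues A \<longleftrightarrow> card {k. eigenvalue A k} = dim_row A"

end

theory Submission
  imports Defs
begin

text \<open>
  Write \<open>A\<close> for the Kac--Murdock--Szego matrix and \<open>B\<close> for the bidiagonal matrix with
  superdiagonal \<open>- \<rho>\<close>. Along a row of \<open>A\<close> the entries right of the diagonal form a geometric
  progression with ratio \<open>\<rho>\<close>, so subtracting from each column \<open>\<rho>\<close> times its left neighbour clears
  them: \<open>A B\<close> is lower triangular, equal to \<open>K D\<close> with \<open>K\<close> the matrix of the \<open>\<rho> ^ (i - j)\<close>,
  \<open>j \<le> i\<close> (\<open>kms_mult_bidiag\<close>). By the same telescoping \<open>B\<^sup>T K = 1\<close>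
  (\<open>bidiag_transpose_mult_low\<close>). Therefore \<open>K = L\<close>, \<open>A = L D L\<^sup>T\<close>, and the determinant, the inverse
  and the tridiagonal form of the inverse are read off from the factors.

  Every minor of \<open>A\<close> has the form \<open>det (\<rho> ^ \<bar>x r - y s\<bar>)\<close> with monotone \<open>x\<close> and \<open>y\<close>. After
  transposing if necessary \<open>x 1 \<le> y 1\<close>; then all points \<open>y s\<close> with \<open>s \<ge> 1\<close> lie to the right of
  \<open>x 0\<close> and \<open>x 1\<close>, so the first two rows are proportional outside the first column. Eliminating
  the first row leaves one entry, nonnegative by the triangle inequality, times a smaller
  determinant of the same form (\<open>power_kernel_det_nonneg\<close>). This avoids both the Cauchy--Binet
  formula and division by \<open>\<rho>\<close>.

  For the eigenvalues, the rows of \<open>B D\<^sup>-\<^sup>1 B\<^sup>T\<close> impose a three-term recurrence solved by the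
  sampled wave \<open>sin (k \<theta>) - \<rho> sin ((k - 1) \<theta>)\<close>. This combination satisfies the boundary
  condition of the first row for all \<open>\<theta>\<close>; that of the last row is a single equation for \<open>\<theta>\<close>
  (\<open>kms_eigenvalue\<close>). Its left hand side alternates in sign near \<open>0\<close>, at the points
  \<open>k \<pi> / n\<close> for \<open>0 < k < n\<close>, and near \<open>\<pi>\<close>, which gives \<open>n\<close> solutions in \<open>(0, \<pi>)\<close>
  (\<open>kms_secular_zeros\<close>). The eigenvalue \<open>(1 - \<rho>\<^sup>2) / (1 + \<rho>\<^sup>2 - 2 \<rho> cos \<theta>)\<close> is an injective
  function of \<open>\<theta>\<close> when \<open>\<rho> \<noteq> 0\<close>, so they yield \<open>n\<close> different eigenvalues.
\<close>

section \<open>Factorization, determinant and inverse\<close>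

lemma row_bidiag_scalar_prod:
  assumes "i < n" "v \<in> carrier_vec n"
  shows "row (bidiag_mat n c) i \<bullet> v = v $ i + (if Suc i < n then c * v $ Suc i else 0)"
proof -
  have "row (bidiag_mat n c) i \<bullet> v =
      (\<Sum>k\<in>{0..<n}. (if k = i then v $ k else 0) + (if k = Suc i then c * v $ k else 0))"
    using assms by (auto simp: scalar_prod_def bidiag_mat_def intro!: sum.cong)
  also have "\<dots> = v $ i + (if Suc i < n then c * v $ Suc i else 0)"
    using assms by (simp add: sum.distrib)
  finally show ?thesis .
qed

lemma col_bidiag_scalar_prod:
  assumes "j < n" "v \<in> carrier_vec n"
  shows "col (bidiag_mat n c) j \<bullet> v = v $ j + (if 0 < j then c * v $ (j - 1) else 0)"
proof -
  have "col (bidiag_mat n c) j \<bullet> v =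
      (\<Sum>k\<in>{0..<n}. (if k = j then v $ k else 0) + (if k = j - 1 then if 0 < j then c * v $ k else 0 else 0))"
    using assms by (auto simp: scalar_prod_def bidiag_mat_def intro!: sum.cong)
  also have "\<dots> = v $ j + (if 0 < j then c * v $ (j - 1) else 0)"
    using assms by (auto simp: sum.distrib)
  finally show ?thesis .
qed

lemma bidiag_carrier [simp]: "bidiag_mat n c \<in> carrier_mat n n"
  by (simp add: bidiag_mat_def)

lemma bidiag_dim [simp]: "dim_row (bidiag_mat n c) = n" "dim_col (bidiag_mat n c) = n"
  by (simp_all add: bidiag_mat_def)

lemma kms_carrier [simp]: "kms_mat n \<rho> \<in> carrier_mat n n"
  by (simp add: kms_mat_def)

lemma kms_dim [simp]: "dim_row (kms_mat n \<rho>) = n" "dim_col (kms_mat n \<rho>) = n"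
  by (simp_all add: kms_mat_def)

lemma kms_D_carrier [simp]: "kms_D n \<rho> \<in> carrier_mat n n"
  by (simp add: kms_D_def)

definition kms_low :: "nat \<Rightarrow> real \<Rightarrow> real mat" where
  "kms_low n \<rho> = mat n n (\<lambda>(i, j). if j \<le> i then \<rho> ^ (i - j) else 0)"

lemma low_carrier [simp]: "kms_low n \<rho> \<in> carrier_mat n n"
  by (simp add: kms_low_def)

lemma low_dim [simp]: "dim_row (kms_low n \<rho>) = n" "dim_col (kms_low n \<rho>) = n"
  by (simp_all add: kms_low_def)

lemma right_inverse_imp_mat_inv:
  fixes A :: "'a :: field mat"
  assumes A: "A \<in> carrier_mat n n" and X: "X \<in> carrier_mat n n" and AX: "A * X = 1\<^sub>m n"
  shows "invertible_mat A" "mat_inv A = X"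
proof -
  have XA: "X * A = 1\<^sub>m n" using mat_mult_left_right_inverse[OF A X AX] .
  show inv: "invertible_mat A"
    using A X AX XA unfolding invertible_mat_def inverts_mat_def by auto
  note I = mat_inv_invertible[OF A inv]
  have "mat_inv A = (X * A) * mat_inv A" using I XA by simp
  also have "\<dots> = X * (A * mat_inv A)" using A X I by (simp add: assoc_mult_mat)
  finally show "mat_inv A = X" using I X by simp
qed

lemma bidiag_transpose_mult_low:
  "(bidiag_mat n (- \<rho>))\<^sup>T * kms_low n \<rho> = 1\<^sub>m n"
proof (rule eq_matI)
  fix i j assume "i < dim_row (1\<^sub>m n :: real mat)" "j < dim_col (1\<^sub>m n :: real mat)"
  then have ij: "i < n" "j < n" by auto
  then have "((bidiag_mat n (- \<rho>))\<^sup>T * kms_low n \<rho>) $$ (i, j) =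
      col (bidiag_mat n (- \<rho>)) i \<bullet> col (kms_low n \<rho>) j"
    by simp
  also have "\<dots> = (if i = j then 1 else 0)"
    using ij by (cases i) (auto simp: col_bidiag_scalar_prod carrier_vecI kms_low_def Suc_diff_le)
  finally show "((bidiag_mat n (- \<rho>))\<^sup>T * kms_low n \<rho>) $$ (i, j) = 1\<^sub>m n $$ (i, j)"
    using ij by simp
qed auto

lemma low_mult_bidiag_transpose: "kms_low n \<rho> * (bidiag_mat n (- \<rho>))\<^sup>T = 1\<^sub>m n"
  by (rule mat_mult_left_right_inverse[OF _ _ bidiag_transpose_mult_low]) auto

lemma bidiag_mult_low_transpose:
  "bidiag_mat n (- \<rho>) * (kms_low n \<rho>)\<^sup>T = 1\<^sub>m n"
proof -
  have "(kms_low n \<rho>)\<^sup>T * bidiag_mat n (- \<rho>) = ((bidiag_mat n (- \<rho>))\<^sup>T * kms_low n \<rho>)\<^sup>T"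
    by (subst transpose_mult[of _ n n _ n]) auto
  then have "(kms_low n \<rho>)\<^sup>T * bidiag_mat n (- \<rho>) = 1\<^sub>m n"
    by (simp add: bidiag_transpose_mult_low)
  from mat_mult_left_right_inverse[OF _ _ this] show ?thesis by simp
qed

lemma invertible_bidiag: "invertible_mat (bidiag_mat n (- \<rho>))"
  by (rule right_inverse_imp_mat_inv(1)[OF _ _ bidiag_mult_low_transpose]) auto

lemma kms_L_eq: "kms_L n \<rho> = kms_low n \<rho>"
  using right_inverse_imp_mat_inv(2)[OF _ _ bidiag_mult_low_transpose, of n \<rho>]
  by (simp add: kms_L_def)

lemma kms_mult_bidiag: "kms_mat n \<rho> * bidiag_mat n (- \<rho>) = kms_low n \<rho> * kms_D n \<rho>"
proof (rule eq_matI)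
  fix i j assume "i < dim_row (kms_low n \<rho> * kms_D n \<rho>)" "j < dim_col (kms_low n \<rho> * kms_D n \<rho>)"
  then have ij: "i < n" "j < n" by (auto simp: kms_D_def mat_diag_def)
  have "(kms_mat n \<rho> * bidiag_mat n (- \<rho>)) $$ (i, j) =
      col (bidiag_mat n (- \<rho>)) j \<bullet> row (kms_mat n \<rho>) i"
    using ij by (simp add: comm_scalar_prod[of _ n] carrier_vecI)
  also have "\<dots> = kms_mat n \<rho> $$ (i, j) + (if 0 < j then - \<rho> * kms_mat n \<rho> $$ (i, j - 1) else 0)"
    using ij by (simp add: col_bidiag_scalar_prod carrier_vecI)
  also have "\<dots> = kms_low n \<rho> $$ (i, j) * (if j = 0 then 1 else 1 - \<rho>\<^sup>2)"
  proof (cases j)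
    case 0
    then show ?thesis using ij by (simp add: kms_mat_def kms_low_def)
  next
    case (Suc k)
    show ?thesis
    proof (cases "j \<le> i")
      case True
      then have "nat \<bar>int i - int j\<bar> = i - j" "nat \<bar>int i - int k\<bar> = Suc (i - j)"
        using Suc by auto
      then show ?thesis using ij Suc True
        by (simp add: kms_mat_def kms_low_def power2_eq_square algebra_simps)
    next
      case False
      then have "nat \<bar>int i - int j\<bar> = Suc (nat \<bar>int i - int k\<bar>)"
        using Suc by auto
      then show ?thesis using ij Suc False
        by (simp add: kms_mat_def kms_low_def)
    qed
  qed
  also have "\<dots> = (kms_low n \<rho> * kms_D n \<rho>) $$ (i, j)"
    unfolding kms_D_def using ij by (subst mat_diag_mult_right[OF low_carrier]) simp
  finally show "(kms_mat n \<rho> * bidiag_mat n (- \<rho>)) $$ (i, j) = (kms_low n \<rho> * kms_D n \<rho>) $$ (i, j)" .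
qed (auto simp: kms_D_def mat_diag_def)

lemma kms_factorization:
  "kms_mat n \<rho> = kms_low n \<rho> * kms_D n \<rho> * (kms_low n \<rho>)\<^sup>T"
proof -
  have "kms_mat n \<rho> = kms_mat n \<rho> * (bidiag_mat n (- \<rho>) * (kms_low n \<rho>)\<^sup>T)"
    by (simp add: bidiag_mult_low_transpose right_mult_one_mat[OF kms_carrier])
  also have "\<dots> = (kms_mat n \<rho> * bidiag_mat n (- \<rho>)) * (kms_low n \<rho>)\<^sup>T"
    by (subst assoc_mult_mat[of _ n n _ n _ n]) auto
  finally show ?thesis by (simp add: kms_mult_bidiag)
qed

lemma det_low: "det (kms_low n \<rho>) = 1"
proof -
  have "diag_mat (kms_low n \<rho>) = replicate n 1"
    by (auto simp: diag_mat_def kms_low_def intro: nth_equalityI)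
  then show ?thesis
    using det_lower_triangular[OF _ low_carrier, of n \<rho>] by (simp add: kms_low_def)
qed

lemma det_kms_D:
  assumes "1 \<le> n"
  shows "det (kms_D n \<rho>) = (1 - \<rho>\<^sup>2) ^ (n - 1)"
proof -
  obtain m where n: "n = Suc m" using assms by (cases n) auto
  have "det (kms_D n \<rho>) = prod_list (diag_mat (kms_D n \<rho>))"
    by (rule det_upper_triangular[of _ n]) (auto simp: kms_D_def mat_diag_def)
  also have "diag_mat (kms_D n \<rho>) = 1 # replicate m (1 - \<rho>\<^sup>2)"
    by (rule nth_equalityI)
       (auto simp: diag_mat_def kms_D_def mat_diag_def n nth_Cons split: nat.split simp del: upt_Suc)
  finally show ?thesis by (simp add: n)
qed

lemma det_kms:
  assumes "1 \<le> n"
  shows "det (kms_mat n \<rho>) = (1 - \<rho>\<^sup>2) ^ (n - 1)"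
proof -
  have "det (kms_mat n \<rho>) = det (kms_low n \<rho>) * det (kms_D n \<rho>) * det ((kms_low n \<rho>)\<^sup>T)"
    by (simp add: kms_factorization det_mult[OF low_carrier kms_D_carrier]
        det_mult[OF mult_carrier_mat[OF low_carrier kms_D_carrier]])
  then show ?thesis by (simp add: det_transpose[OF low_carrier] det_low det_kms_D[OF assms])
qed

lemma kms_D_inverse:
  assumes "\<rho>\<^sup>2 \<noteq> 1"
  shows "invertible_mat (kms_D n \<rho>)"
    and "mat_inv (kms_D n \<rho>) = mat_diag n (\<lambda>i. if i = 0 then 1 else 1 / (1 - \<rho>\<^sup>2))" (is "_ = ?E")
proof -
  have "kms_D n \<rho> * ?E = mat_diag n (\<lambda>i. 1)"
    unfolding kms_D_def mat_diag_diag using assms by (intro arg_cong[of _ _ "mat_diag n"]) auto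
  then have "kms_D n \<rho> * ?E = 1\<^sub>m n" by simp
  note * = right_inverse_imp_mat_inv[OF kms_D_carrier mat_diag_dim this]
  from * show "invertible_mat (kms_D n \<rho>)" "mat_inv (kms_D n \<rho>) = ?E" by auto
qed

lemma kms_inverse:
  assumes "\<rho>\<^sup>2 \<noteq> 1"
  shows "invertible_mat (kms_mat n \<rho>)"
    and "mat_inv (kms_mat n \<rho>) =
      bidiag_mat n (- \<rho>) * mat_inv (kms_D n \<rho>) * (bidiag_mat n (- \<rho>))\<^sup>T"
proof -
  define B where "B = bidiag_mat n (- \<rho>)"
  have B: "B \<in> carrier_mat n n" by (simp add: B_def)
  define E where "E = mat_inv (kms_D n \<rho>)"
  note D = mat_inv_invertible[OF kms_D_carrier kms_D_inverse(1)[OF assms], of n, folded E_def]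
  have "kms_mat n \<rho> * (B * E * B\<^sup>T) = kms_mat n \<rho> * B * E * B\<^sup>T"
    using B D by (simp add: assoc_mult_mat[of _ n n _ n _ n])
  also have "\<dots> = kms_low n \<rho> * (kms_D n \<rho> * E) * B\<^sup>T"
    unfolding B_def kms_mult_bidiag using D by (simp add: assoc_mult_mat[of _ n n _ n _ n])
  also have "\<dots> = kms_low n \<rho> * B\<^sup>T"
    using D by (simp add: right_mult_one_mat[OF low_carrier])
  also have "\<dots> = 1\<^sub>m n"
    unfolding B_def by (rule low_mult_bidiag_transpose)
  finally have "kms_mat n \<rho> * (B * E * B\<^sup>T) = 1\<^sub>m n" .
  note * = right_inverse_imp_mat_inv[OF kms_carrier mult_carrier_mat[OF mult_carrier_mat[OF B D(1)]] this]
  show "invertible_mat (kms_mat n \<rho>)"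
    "mat_inv (kms_mat n \<rho>) =
      bidiag_mat n (- \<rho>) * mat_inv (kms_D n \<rho>) * (bidiag_mat n (- \<rho>))\<^sup>T"
    using *[OF transpose_carrier_mat[THEN iffD2, OF B]] unfolding E_def B_def by blast+
qed

lemma kms_inverse_tridiag:
  assumes "\<rho>\<^sup>2 \<noteq> 1" "2 \<le> n"
  shows "mat_inv (kms_mat n \<rho>) = (1 / (1 - \<rho>\<^sup>2)) \<cdot>\<^sub>m kms_tridiag n \<rho>"
proof (rule eq_matI)
  let ?B = "bidiag_mat n (- \<rho>)"
  define d where "d i = (if i = 0 then 1 else 1 / (1 - \<rho>\<^sup>2))" for i :: nat
  define s where "s = 1 - \<rho>\<^sup>2"
  have s: "s \<noteq> 0" "1 - \<rho>\<^sup>2 = s" "\<rho>\<^sup>2 = 1 - s" using assms by (auto simp: s_def)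
  have E: "mat_inv (kms_D n \<rho>) = mat_diag n d"
    using kms_D_inverse(2)[OF assms(1)] by (simp add: d_def[abs_def])
  have inv: "mat_inv (kms_mat n \<rho>) = ?B * (mat_diag n d * ?B\<^sup>T)"
    unfolding kms_inverse(2)[OF assms(1)] E by (rule assoc_mult_mat[of _ n n _ n _ n]) auto
  have DBT: "mat_diag n d * ?B\<^sup>T = mat n n (\<lambda>(i, j). d i * ?B $$ (j, i))"
    by (subst mat_diag_mult_left[of _ n n]) (auto intro: eq_matI)
  fix i j assume "i < dim_row ((1 / (1 - \<rho>\<^sup>2)) \<cdot>\<^sub>m kms_tridiag n \<rho>)"
    "j < dim_col ((1 / (1 - \<rho>\<^sup>2)) \<cdot>\<^sub>m kms_tridiag n \<rho>)"
  then have ij: "i < n" "j < n" by (auto simp: kms_tridiag_def)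
  have "mat_inv (kms_mat n \<rho>) $$ (i, j) =
      d i * ?B $$ (j, i) + (if Suc i < n then - \<rho> * (d (Suc i) * ?B $$ (j, Suc i)) else 0)"
    unfolding inv DBT using ij by (simp add: row_bidiag_scalar_prod carrier_vecI)
  also have "\<dots> = ((1 / (1 - \<rho>\<^sup>2)) \<cdot>\<^sub>m kms_tridiag n \<rho>) $$ (i, j)"
    using ij s assms(2) unfolding d_def s(2)
    by (auto simp: bidiag_mat_def kms_tridiag_def field_simps power2_eq_square)
  finally show "mat_inv (kms_mat n \<rho>) $$ (i, j) = ((1 / (1 - \<rho>\<^sup>2)) \<cdot>\<^sub>m kms_tridiag n \<rho>) $$ (i, j)" .
qed (use kms_inverse(2)[OF assms(1), of n] in \<open>auto simp: kms_tridiag_def\<close>)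

section \<open>Total nonnegativity\<close>

text \<open>
  The points \<open>x r\<close> and \<open>y s\<close> need only be weakly increasing, so that passing to
  \<open>x \<circ> Suc\<close> and \<open>y \<circ> Suc\<close> stays within the same class and the induction closes.
\<close>
lemma power_kernel_det_nonneg:
  fixes x y :: "nat \<Rightarrow> nat" and \<rho> :: real
  assumes \<rho>: "0 \<le> \<rho>" "\<rho> \<le> 1"
    and "mono_on {..<m} x" "mono_on {..<m} y"
  shows "0 \<le> det (mat m m (\<lambda>(r, s). \<rho> ^ nat \<bar>int (x r) - int (y s)\<bar>))"
  using assms(3,4)
proof (induction m arbitrary: x y)
  case 0
  then show ?case by (simp add: det_def)
next
  case (Suc m)
  define M where "M x y = mat (Suc m) (Suc m) (\<lambda>(r, s). \<rho> ^ nat \<bar>int (x r) - int (y s)\<bar>)"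
    for x y :: "nat \<Rightarrow> nat"
  have carr: "M x y \<in> carrier_mat (Suc m) (Suc m)" for x y by (simp add: M_def)
  have main: "0 \<le> det (M x y)"
    if x: "mono_on {..<Suc m} x" and y: "mono_on {..<Suc m} y" and xy: "m = 0 \<or> x 1 \<le> y 1" for x y
  proof -
    have "\<exists>P c. P \<in> carrier_mat (Suc m) (Suc m) \<and> det P = det (M x y) \<and> 0 \<le> c \<and>
        (\<forall>s \<le> m. P $$ (0, s) = (if s = 0 then c else 0)) \<and>
        (\<forall>r \<le> m. \<forall>s \<le> m. 0 < r \<longrightarrow> P $$ (r, s) = M x y $$ (r, s))"
    proof (cases "m = 0")
      case True
      then show ?thesis
        using \<rho> by (intro exI[of _ "M x y"] exI[of _ "M x y $$ (0, 0)"]) (auto simp: M_def)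
    next
      case False
      \<comment> \<open>For \<open>s \<ge> 1\<close> the path from \<open>x 0\<close> to \<open>y s\<close> passes \<open>x 1\<close>, so entry \<open>(0, s)\<close> is
        \<open>\<rho> ^ (x 1 - x 0)\<close> times entry \<open>(1, s)\<close>.\<close>
      define a where "a = - (\<rho> ^ (x 1 - x 0))"
      define P where "P = addrow a 0 1 (M x y)"
      define c where "c = P $$ (0, 0)"
      have x01: "x 0 \<le> x 1" using monotone_onD[OF x, of 0 1] False by simp
      have P0: "P $$ (0, s) = \<rho> ^ nat \<bar>int (x 0) - int (y s)\<bar> -
          \<rho> ^ ((x 1 - x 0) + nat \<bar>int (x 1) - int (y s)\<bar>)" if "s \<le> m" for s
        using that False by (simp add: P_def M_def a_def power_add)
      have "P $$ (0, s) = 0" if "0 < s" "s \<le> m" for s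
      proof -
        have "y 1 \<le> y s" using monotone_onD[OF y, of 1 s] that by simp
        then have "nat \<bar>int (x 0) - int (y s)\<bar> = (x 1 - x 0) + nat \<bar>int (x 1) - int (y s)\<bar>"
          using x01 xy False by linarith
        then show ?thesis using P0 that by simp
      qed
      moreover have "0 \<le> c"
      proof -
        have "nat \<bar>int (x 0) - int (y 0)\<bar> \<le> (x 1 - x 0) + nat \<bar>int (x 1) - int (y 0)\<bar>"
          using x01 by linarith
        then show ?thesis unfolding c_def using P0[of 0] \<rho> by (simp add: power_decreasing)
      qed
      moreover have "det P = det (M x y)"
        unfolding P_def using False by (intro det_addrow[OF _ _ carr]) auto
      moreover have "P $$ (r, s) = M x y $$ (r, s)" if "r \<le> m" "s \<le> m" "0 < r" for r s
        using that by (simp add: P_def M_def)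
      ultimately show ?thesis
        using carr by (intro exI[of _ P] exI[of _ c]) (auto simp: P_def c_def)
    qed
    then obtain P c where P: "P \<in> carrier_mat (Suc m) (Suc m)" "det P = det (M x y)" "0 \<le> c"
      "\<And>s. s \<le> m \<Longrightarrow> P $$ (0, s) = (if s = 0 then c else 0)"
      "\<And>r s. r \<le> m \<Longrightarrow> s \<le> m \<Longrightarrow> 0 < r \<Longrightarrow> P $$ (r, s) = M x y $$ (r, s)"
      by blast
    have "det P = (\<Sum>s<Suc m. P $$ (0, s) * cofactor P 0 s)"
      by (rule laplace_expansion_row[OF P(1)]) simp
    also have "\<dots> = (\<Sum>s<Suc m. if s = 0 then c * cofactor P 0 0 else 0)"
      by (rule sum.cong) (auto simp: P(4))
    also have "\<dots> = c * det (mat_delete P 0 0)" by (simp add: cofactor_def)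
    also have "mat_delete P 0 0 =
        mat m m (\<lambda>(r, s). \<rho> ^ nat \<bar>int ((x \<circ> Suc) r) - int ((y \<circ> Suc) s)\<bar>)"
      using P(1,5) by (auto simp: mat_delete_def M_def intro!: eq_matI)
    finally have detP: "det P = c * det (mat m m (\<lambda>(r, s). \<rho> ^ nat \<bar>int ((x \<circ> Suc) r) - int ((y \<circ> Suc) s)\<bar>))" .
    have mono: "mono_on {..<m} (x \<circ> Suc)" "mono_on {..<m} (y \<circ> Suc)"
      using x y by (auto simp: monotone_on_def)
    show ?thesis using mult_nonneg_nonneg[OF P(3) Suc.IH[OF mono]] detP P(2) by simp
  qed
  show ?case
  proof (cases "m = 0 \<or> x 1 \<le> y 1")
    case True
    then show ?thesis using main[of x y] Suc.prems by (simp add: M_def)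
  next
    case False
    have "M x y = (M y x)\<^sup>T"
      by (auto simp: M_def abs_minus_commute intro!: eq_matI)
    moreover have "0 \<le> det (M y x)" using False Suc.prems by (intro main) auto
    ultimately have "0 \<le> det (M x y)" by (simp add: det_transpose[OF carr])
    then show ?thesis by (simp add: M_def)
  qed
qed

lemma mono_on_pick: "mono_on {..<card I} (pick I)"
proof (rule monotone_onI)
  fix r s assume "r \<in> {..<card I}" "s \<in> {..<card I}" "r \<le> s"
  then show "pick I r \<le> pick I s"
    using pick_mono_le[of s I r] by (cases "r = s") auto
qed

lemma kms_totally_nonneg:
  assumes "0 \<le> \<rho>" "\<rho> \<le> 1"
  shows "totally_nonneg (kms_mat n \<rho>)"
  unfolding totally_nonneg_def
proof (intro allI impI)
  fix I J assume "I \<subseteq> {..<dim_row (kms_mat n \<rho>)}" "J \<subseteq> {..<dim_col (kms_mat n \<rho>)}"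
    and card: "card I = card J"
  then have IJ: "I \<subseteq> {..<n}" "J \<subseteq> {..<n}" by auto
  have I: "{i. i < n \<and> i \<in> I} = I" and J: "{j. j < n \<and> j \<in> J} = J" using IJ by auto
  have "pick I r < n" if "r < card I" for r using pick_in_set_le[OF that] IJ by auto
  moreover have "pick J s < n" if "s < card I" for s using pick_in_set_le[of s J] that card IJ by auto
  ultimately have "submatrix (kms_mat n \<rho>) I J =
      mat (card I) (card I) (\<lambda>(r, s). \<rho> ^ nat \<bar>int (pick I r) - int (pick J s)\<bar>)"
    unfolding submatrix_def by (auto simp: I J card kms_mat_def intro!: eq_matI)
  then show "0 \<le> det (submatrix (kms_mat n \<rho>) I J)"
    using power_kernel_det_nonneg[OF assms mono_on_pick[of I], of "pick J"] mono_on_pick[of J] card by simp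
qed


section \<open>Eigenvalues\<close>

text \<open>
  The intervals between consecutive sample points are disjoint, so the zeros that the
  intermediate value theorem puts into them are different.
\<close>
lemma alternating_imp_zeros:
  fixes f t :: "_ \<Rightarrow> real"
  assumes cont: "continuous_on UNIV f"
    and "\<And>k. k < n \<Longrightarrow> t k < t (Suc k)"
    and "\<And>k. k \<le> n \<Longrightarrow> 0 < (- 1) ^ k * f (t k)"
  shows "\<exists>Z. Z \<subseteq> {t 0<..<t n} \<and> finite Z \<and> card Z = n \<and> (\<forall>z\<in>Z. f z = 0)"
  using assms(2,3)
proof (induction n)
  case 0
  then show ?case by auto
next
  case (Suc n)
  obtain Z where Z: "Z \<subseteq> {t 0<..<t n}" "finite Z" "card Z = n" "\<forall>z\<in>Z. f z = 0"
    using Suc.IH Suc.prems by fastforce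
  have "t 0 \<le> t k" if "k \<le> n" for k
    using that
  proof (induction k)
    case (Suc k)
    then show ?case using Suc.prems \<open>\<And>k. k < Suc n \<Longrightarrow> t k < t (Suc k)\<close>[of k] by simp
  qed simp
  then have tt: "t 0 \<le> t n" by simp
  have t: "t n < t (Suc n)" using Suc.prems(1) by simp
  define g where "g x = (- 1) ^ n * f x" for x
  have g: "0 < g (t n)" "g (t (Suc n)) < 0"
    using Suc.prems(2)[of n] Suc.prems(2)[of "Suc n"] by (auto simp: g_def)
  have "continuous_on {t n..t (Suc n)} g"
    unfolding g_def by (intro continuous_intros continuous_on_subset[OF cont]) auto
  then obtain z where z: "t n \<le> z" "z \<le> t (Suc n)" "g z = 0"
    using IVT2'[of g "t (Suc n)" 0 "t n"] g t by auto
  then have "z \<noteq> t n" "z \<noteq> t (Suc n)" using g by auto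
  then have z': "t n < z" "z < t (Suc n)" using z by auto
  have "z \<notin> Z" using Z z' by auto
  moreover have "insert z Z \<subseteq> {t 0<..<t (Suc n)}" using Z z' t tt by auto
  moreover have "f z = 0" using z by (simp add: g_def)
  ultimately show ?case using Z by (intro exI[of _ "insert z Z"]) auto
qed

text \<open>
  The combination of the solutions \<open>sin (x \<theta>)\<close> and \<open>sin ((x - 1) \<theta>)\<close> of
  \<open>f (x + 1) + f (x - 1) = 2 cos \<theta> f x\<close> is chosen so that the value at \<open>0\<close> is \<open>\<rho>\<close> times the value at \<open>1\<close>, the boundary condition of the
  first row of the inverse matrix.
\<close>
definition kms_wave :: "real \<Rightarrow> real \<Rightarrow> real \<Rightarrow> real" where
  "kms_wave \<rho> \<theta> x = sin (x * \<theta>) - \<rho> * sin ((x - 1) * \<theta>)"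

text \<open>
  The defect in the boundary condition of the last row, which mirrors that of the first row.
\<close>
definition kms_secular :: "nat \<Rightarrow> real \<Rightarrow> real \<Rightarrow> real" where
  "kms_secular n \<rho> \<theta> = kms_wave \<rho> \<theta> (real n + 1) - \<rho> * kms_wave \<rho> \<theta> (real n)"

lemma kms_wave_recurrence:
  "kms_wave \<rho> \<theta> (x + 1) + kms_wave \<rho> \<theta> (x - 1) = 2 * cos \<theta> * kms_wave \<rho> \<theta> x"
proof -
  have *: "sin ((y + 1) * \<theta>) + sin ((y - 1) * \<theta>) = 2 * cos \<theta> * sin (y * \<theta>)" for y
    by (simp add: distrib_right left_diff_distrib sin_add sin_diff)
  have "kms_wave \<rho> \<theta> (x + 1) + kms_wave \<rho> \<theta> (x - 1) =
      (sin ((x + 1) * \<theta>) + sin ((x - 1) * \<theta>))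
      - \<rho> * (sin ((x - 1 + 1) * \<theta>) + sin ((x - 1 - 1) * \<theta>))"
    by (simp add: kms_wave_def algebra_simps)
  then show ?thesis unfolding * by (simp add: kms_wave_def algebra_simps)
qed

lemma kms_symbol_pos:
  fixes \<rho> :: real
  assumes "-1 < \<rho>" "\<rho> < 1"
  shows "0 < 1 + \<rho>\<^sup>2 - 2 * \<rho> * cos \<theta>"
proof -
  have "\<bar>2 * \<rho> * cos \<theta>\<bar> \<le> 2 * \<bar>\<rho>\<bar>"
    by (simp add: abs_mult mult_left_le)
  moreover have "0 < (1 - \<bar>\<rho>\<bar>)\<^sup>2" using assms by (simp add: abs_if split: if_splits)
  ultimately show ?thesis by (simp add: power2_diff)
qed

text \<open>
  With \<open>D u = B\<^sup>T v\<close> and \<open>B u = (\<mu> / (1 - \<rho>\<^sup>2)) v\<close> the factorization gives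
  \<open>(\<mu> / (1 - \<rho>\<^sup>2)) A v = A B u = L D u = L B\<^sup>T v = v\<close>. Keeping the two bidiagonal factors
  apart, instead of using the tridiagonal inverse, treats \<open>n = 1\<close> together with the other sizes
  and needs no special first row: by the boundary condition at \<open>0\<close> the general formula for \<open>u\<close>
  also holds at index \<open>0\<close>, where the entry of \<open>D\<close> is \<open>1\<close>.
\<close>
lemma kms_eigenvalue:
  assumes n: "1 \<le> n" and \<rho>: "-1 < \<rho>" "\<rho> < 1"
    and \<theta>: "0 < \<theta>" "\<theta> < pi" and sec: "kms_secular n \<rho> \<theta> = 0"
  shows "eigenvalue (kms_mat n \<rho>) ((1 - \<rho>\<^sup>2) / (1 + \<rho>\<^sup>2 - 2 * \<rho> * cos \<theta>))"
proof -
  let ?B = "bidiag_mat n (- \<rho>)" and ?V = "kms_wave \<rho> \<theta>"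
  define q where "q = 1 - \<rho>\<^sup>2"
  define \<mu> where "\<mu> = 1 + \<rho>\<^sup>2 - 2 * \<rho> * cos \<theta>"
  have q: "0 < q" using \<rho> by (simp add: q_def abs_square_less_1 abs_less_iff)
  have \<mu>: "0 < \<mu>" unfolding \<mu>_def by (rule kms_symbol_pos[OF \<rho>])
  define v where "v = vec n (\<lambda>j. ?V (real j + 1))"
  define u where "u = vec n (\<lambda>j. (?V (real j + 1) - \<rho> * ?V (real j)) / q)"
  have carr: "v \<in> carrier_vec n" "u \<in> carrier_vec n" by (simp_all add: v_def u_def)
  have V0: "?V 0 = \<rho> * ?V 1" by (simp add: kms_wave_def)
  have BTv: "?B\<^sup>T *\<^sub>v v = kms_D n \<rho> *\<^sub>v u"
  proof (rule eq_vecI)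
    fix i assume "i < dim_vec (kms_D n \<rho> *\<^sub>v u)"
    then have i: "i < n" by (simp add: kms_D_def mat_diag_def)
    have "(kms_D n \<rho> *\<^sub>v u) $ i = (\<Sum>k\<in>{0..<n}. kms_D n \<rho> $$ (i, k) * u $ k)"
      using i carr by (simp add: kms_D_def mat_diag_def scalar_prod_def)
    also have "\<dots> = (\<Sum>k\<in>{0..<n}. if k = i then (if i = 0 then 1 else q) * u $ k else 0)"
      by (rule sum.cong) (use i in \<open>auto simp: kms_D_def mat_diag_def q_def\<close>)
    also have "\<dots> = (if i = 0 then 1 else q) * u $ i" using i by simp
    also have "\<dots> = v $ i + (if 0 < i then - \<rho> * v $ (i - 1) else 0)"
      using i q V0 by (cases i)
        (auto simp: u_def v_def q_def power2_eq_square field_simps of_nat_diff)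
    also have "\<dots> = (?B\<^sup>T *\<^sub>v v) $ i"
      using i carr by (simp add: col_bidiag_scalar_prod)
    finally show "(?B\<^sup>T *\<^sub>v v) $ i = (kms_D n \<rho> *\<^sub>v u) $ i" ..
  qed (simp add: kms_D_def mat_diag_def)
  have Bu: "?B *\<^sub>v u = (\<mu> / q) \<cdot>\<^sub>v v"
  proof (rule eq_vecI)
    fix i assume "i < dim_vec ((\<mu> / q) \<cdot>\<^sub>v v)"
    then have i: "i < n" by (simp add: v_def)
    have "(?B *\<^sub>v u) $ i = u $ i + (if Suc i < n then - \<rho> * u $ Suc i else 0)"
      using i carr by (simp add: row_bidiag_scalar_prod)
    also have "(if Suc i < n then - \<rho> * u $ Suc i else 0) =
        - \<rho> * ((?V (real i + 2) - \<rho> * ?V (real i + 1)) / q)"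
    proof (cases "Suc i < n")
      case True
      then show ?thesis by (simp add: u_def add.commute)
    next
      case False
      \<comment> \<open>The formula for \<open>u\<close> vanishes at the missing index \<open>n\<close>: this is the secular equation.\<close>
      then have "real n = real i + 1" using i by simp
      then show ?thesis using sec False by (simp add: kms_secular_def add.commute)
    qed
    also have "u $ i + \<dots> = ((1 + \<rho>\<^sup>2) * ?V (real i + 1) - \<rho> * (?V (real i + 2) + ?V (real i))) / q"
      using i q by (simp add: u_def field_simps power2_eq_square)
    also have "?V (real i + 2) + ?V (real i) = 2 * cos \<theta> * ?V (real i + 1)"
      using kms_wave_recurrence[of \<rho> \<theta> "real i + 1"] by (simp add: add.commute)
    also have "((1 + \<rho>\<^sup>2) * ?V (real i + 1) - \<rho> * (2 * cos \<theta> * ?V (real i + 1))) / q = (\<mu> / q) * v $ i"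
      using i by (simp add: v_def \<mu>_def algebra_simps)
    finally show "(?B *\<^sub>v u) $ i = ((\<mu> / q) \<cdot>\<^sub>v v) $ i" using i carr by simp
  qed (simp add: v_def)
  have "(\<mu> / q) \<cdot>\<^sub>v (kms_mat n \<rho> *\<^sub>v v) = kms_mat n \<rho> *\<^sub>v (?B *\<^sub>v u)"
    unfolding Bu by (rule mult_mat_vec[symmetric, OF kms_carrier carr(1)])
  also have "\<dots> = (kms_low n \<rho> * kms_D n \<rho>) *\<^sub>v u"
    by (simp add: assoc_mult_mat_vec[symmetric, of _ n n _ n] carr kms_mult_bidiag)
  also have "\<dots> = (kms_low n \<rho> * ?B\<^sup>T) *\<^sub>v v"
    by (simp add: assoc_mult_mat_vec[of _ n n _ n] carr BTv)
  also have "\<dots> = v" using carr by (simp add: low_mult_bidiag_transpose)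
  finally have "(q / \<mu>) \<cdot>\<^sub>v ((\<mu> / q) \<cdot>\<^sub>v (kms_mat n \<rho> *\<^sub>v v)) = (q / \<mu>) \<cdot>\<^sub>v v" by simp
  then have "kms_mat n \<rho> *\<^sub>v v = (q / \<mu>) \<cdot>\<^sub>v v"
    using q \<mu> by (simp add: smult_smult_assoc)
  moreover have "v \<noteq> 0\<^sub>v n"
  proof
    assume "v = 0\<^sub>v n"
    then have "v $ 0 = 0" using n by simp
    then have "sin \<theta> = 0" using n by (simp add: v_def kms_wave_def)
    then show False using sin_gt_zero[OF \<theta>] by simp
  qed
  ultimately have "eigenvector (kms_mat n \<rho>) v (q / \<mu>)"
    using carr by (simp add: eigenvector_def)
  then show ?thesis unfolding eigenvalue_def q_def \<mu>_def by blast
qed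

lemma kms_secular_expand:
  "kms_secular n \<rho> \<theta> =
    sin ((real n + 1) * \<theta>) - 2 * \<rho> * sin (real n * \<theta>) + \<rho>\<^sup>2 * sin ((real n - 1) * \<theta>)"
  by (simp add: kms_secular_def kms_wave_def algebra_simps power2_eq_square)

text \<open>
  At a multiple of \<open>\<pi> / n\<close> the middle term vanishes and \<open>sin ((n + 1) \<theta>) = - sin ((n - 1) \<theta>)\<close>.
\<close>
lemma kms_secular_node:
  assumes "1 \<le> n"
  shows "kms_secular n \<rho> (real k * pi / real n) = (- 1) ^ k * ((1 - \<rho>\<^sup>2) * sin (real k * pi / real n))"
proof -
  define \<theta> where "\<theta> = real k * pi / real n"
  have "real n * \<theta> = real k * pi" using assms by (simp add: \<theta>_def)
  then have "sin (real n * \<theta>) = 0" "cos (real n * \<theta>) = (- 1) ^ k" by (simp_all add: cos_npi)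
  then have "kms_secular n \<rho> \<theta> = (- 1) ^ k * ((1 - \<rho>\<^sup>2) * sin \<theta>)"
    by (simp add: kms_secular_expand distrib_right left_diff_distrib sin_add sin_diff)
      (simp add: algebra_simps)
  then show ?thesis by (simp add: \<theta>_def)
qed

text \<open>
  Carries the sign near \<open>0\<close> over to \<open>\<pi>\<close>, with \<open>- \<rho>\<close> in place of \<open>\<rho>\<close>.
\<close>
lemma kms_secular_reflect: "kms_secular n \<rho> (pi - \<theta>) = (- 1) ^ n * kms_secular n (- \<rho>) \<theta>"
proof -
  have s: "sin (real n * (pi - \<theta>)) = - ((- 1) ^ n * sin (real n * \<theta>))"
    and c: "cos (real n * (pi - \<theta>)) = (- 1) ^ n * cos (real n * \<theta>)"
    by (simp_all add: right_diff_distrib sin_diff cos_diff cos_npi)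
  show ?thesis
    by (simp add: kms_secular_expand distrib_right[of "real n"] left_diff_distrib[of "real n"]
        sin_add[of "real n * _"] sin_diff[of "real n * _"] s c)
      (simp add: algebra_simps)
qed

text \<open>
  The secular function vanishes at \<open>0\<close> with slope \<open>n (1 - \<rho>)\<^sup>2 + (1 - \<rho>\<^sup>2) > 0\<close>.
\<close>
lemma kms_secular_pos_near_0:
  assumes \<rho>: "-1 < \<rho>" "\<rho> < 1" and "0 < e"
  shows "\<exists>a. 0 < a \<and> a < e \<and> 0 < kms_secular n \<rho> a"
proof -
  let ?D = "(real n + 1) - 2 * \<rho> * real n + \<rho>\<^sup>2 * (real n - 1)"
  have "DERIV (kms_secular n \<rho>) 0 :> ?D"
    unfolding kms_secular_expand[abs_def] by (auto intro!: derivative_eq_intros)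
  moreover have "0 < ?D"
  proof -
    have "\<rho>\<^sup>2 < 1" using \<rho> by (simp add: abs_square_less_1 abs_less_iff)
    moreover have "?D = real n * (1 - \<rho>)\<^sup>2 + (1 - \<rho>\<^sup>2)"
      by (simp add: power2_eq_square algebra_simps)
    moreover have "0 \<le> real n * (1 - \<rho>)\<^sup>2" by simp
    ultimately show ?thesis by linarith
  qed
  ultimately obtain d where d: "0 < d" "\<And>h. 0 < h \<Longrightarrow> h < d \<Longrightarrow> kms_secular n \<rho> 0 < kms_secular n \<rho> (0 + h)"
    using DERIV_pos_inc_right[of "kms_secular n \<rho>" ?D 0] by blast
  have "kms_secular n \<rho> 0 = 0" by (simp add: kms_secular_expand)
  then show ?thesis
    using d(1) d(2)[of "min d e / 2"] \<open>0 < e\<close> by (intro exI[of _ "min d e / 2"]) auto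
qed

lemma kms_secular_zeros:
  assumes n: "1 \<le> n" and \<rho>: "-1 < \<rho>" "\<rho> < 1"
  shows "\<exists>Z. Z \<subseteq> {0<..<pi} \<and> card Z = n \<and> (\<forall>\<theta>\<in>Z. kms_secular n \<rho> \<theta> = 0)"
proof -
  have q: "0 < 1 - \<rho>\<^sup>2" using \<rho> by (simp add: abs_square_less_1 abs_less_iff)
  \<comment> \<open>Half the node distance, so that the sample points near \<open>0\<close> and \<open>\<pi>\<close> stay apart even for
    \<open>n = 1\<close>.\<close>
  define e where "e = pi / (2 * real n)"
  have e: "0 < e" "pi / real n = 2 * e" "pi = 2 * real n * e" using n by (auto simp: e_def)
  obtain a where a: "0 < a" "a < e" "0 < kms_secular n \<rho> a"
    using kms_secular_pos_near_0[OF \<rho> e(1)] by blast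
  obtain b where b: "0 < b" "b < e" "0 < kms_secular n (- \<rho>) b"
    using kms_secular_pos_near_0[of "- \<rho>" e n] \<rho> e(1) by auto
  define t where "t k = (if k = 0 then a else if k = n then pi - b else real k * pi / real n)" for k
  have node: "real k * pi / real n = 2 * real k * e" for k
    using arg_cong[OF e(2), of "\<lambda>x. real k * x"] by simp
  have mono: "t k < t (Suc k)" if "k < n" for k
  proof -
    consider "k = 0" "n = 1" | "k = 0" "1 < n" | "0 < k" "Suc k = n" | "0 < k" "Suc k < n"
      using \<open>k < n\<close> by (cases "k = 0"; cases "Suc k = n") auto
    then show ?thesis
    proof cases
      case 1
      then show ?thesis using a b e by (simp add: t_def)
    next
      case 2
      then show ?thesis using a e by (simp add: t_def)
    next
      case 3
      then have "pi = 2 * real k * e + 2 * e" using e(3) by (auto simp: algebra_simps)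
      then show ?thesis using 3 b e(1) unfolding t_def node by simp
    next
      case 4
      then show ?thesis using e(1) unfolding t_def node by (simp add: algebra_simps)
    qed
  qed
  have sign: "0 < (- 1) ^ k * kms_secular n \<rho> (t k)" if "k \<le> n" for k
  proof -
    consider "k = 0" | "0 < k" "k = n" | "0 < k" "k < n"
      using \<open>k \<le> n\<close> by (cases "k = 0"; cases "k = n") auto
    then show ?thesis
    proof cases
      case 1
      then show ?thesis using a by (simp add: t_def)
    next
      case 2
      have "(- 1) ^ n * ((- 1) ^ n * c) = (c :: real)" for c
        by (simp add: mult.assoc[symmetric] power_add[symmetric])
      then show ?thesis using 2 b by (simp add: t_def kms_secular_reflect)
    next
      case 3
      have "0 < real k * pi / real n" "real k * pi / real n < pi"
        using 3 by (auto simp: field_simps)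
      then have s: "0 < sin (real k * pi / real n)" by (rule sin_gt_zero)
      have "(- 1) ^ k * ((- 1) ^ k * c) = (c :: real)" for c
        by (simp add: mult.assoc[symmetric] power_add[symmetric])
      then show ?thesis using 3 q s by (simp add: t_def kms_secular_node[OF n])
    qed
  qed
  have "continuous_on UNIV (kms_secular n \<rho>)"
    unfolding kms_secular_expand[abs_def] by (intro continuous_intros)
  then obtain Z where "Z \<subseteq> {t 0<..<t n}" "card Z = n" "\<forall>\<theta>\<in>Z. kms_secular n \<rho> \<theta> = 0"
    using alternating_imp_zeros[of "kms_secular n \<rho>" n t] mono sign by blast
  moreover have "{t 0<..<t n} \<subseteq> {0<..<pi}" using a b n by (auto simp: t_def)
  ultimately show ?thesis by blast
qed

lemma card_eigenvalues_le:
  fixes A :: "'a :: field mat"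
  assumes A: "A \<in> carrier_mat n n"
  shows "finite {k. eigenvalue A k}" "card {k. eigenvalue A k} \<le> n"
proof -
  have eq: "{k. eigenvalue A k} = {k. poly (char_poly A) k = 0}"
    using eigenvalue_root_char_poly[OF A] by auto
  have deg: "degree (char_poly A) = n" "char_poly A \<noteq> 0"
    using degree_monic_char_poly[OF A] by auto
  show "finite {k. eigenvalue A k}" unfolding eq by (rule poly_roots_finite[OF deg(2)])
  show "card {k. eigenvalue A k} \<le> n" unfolding eq using card_poly_roots_bound[OF deg(2)] deg(1) by simp
qed

lemma kms_distinct_eigenvalues:
  assumes n: "1 \<le> n" and \<rho>: "-1 < \<rho>" "\<rho> < 1" "\<rho> \<noteq> 0"
  shows "has_distinct_eigenvalues (kms_mat n \<rho>)"
proof -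
  let ?ev = "\<lambda>\<theta>. (1 - \<rho>\<^sup>2) / (1 + \<rho>\<^sup>2 - 2 * \<rho> * cos \<theta>)"
  let ?E = "{k. eigenvalue (kms_mat n \<rho>) k}"
  obtain Z where Z: "Z \<subseteq> {0<..<pi}" "card Z = n" "\<forall>\<theta>\<in>Z. kms_secular n \<rho> \<theta> = 0"
    using kms_secular_zeros[OF n \<rho>(1,2)] by blast
  have q: "1 - \<rho>\<^sup>2 \<noteq> 0" using \<rho> by (auto simp: power2_eq_1_iff)
  have "inj_on ?ev Z"
  proof (rule inj_onI)
    fix \<theta> \<phi> assume *: "\<theta> \<in> Z" "\<phi> \<in> Z" "?ev \<theta> = ?ev \<phi>"
    have "1 + \<rho>\<^sup>2 - 2 * \<rho> * cos \<theta> = 1 + \<rho>\<^sup>2 - 2 * \<rho> * cos \<phi>"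
      using *(3) q kms_symbol_pos[OF \<rho>(1,2), of \<theta>] kms_symbol_pos[OF \<rho>(1,2), of \<phi>]
      by (simp add: frac_eq_eq)
    then have "cos \<theta> = cos \<phi>" using \<rho>(3) by simp
    then show "\<theta> = \<phi>"
      using cos_inj_pi[of \<theta> \<phi>] *(1,2) Z(1) by (auto simp: less_imp_le subset_iff)
  qed
  then have "card (?ev ` Z) = n" by (simp add: card_image Z(2))
  moreover have "?ev ` Z \<subseteq> ?E" using Z(1,3) kms_eigenvalue[OF n \<rho>(1,2)] by auto
  ultimately have "n \<le> card ?E"
    using card_mono[OF card_eigenvalues_le(1)[OF kms_carrier]] by metis
  then show ?thesis
    using card_eigenvalues_le(2)[OF kms_carrier, of n \<rho>] by (simp add: has_distinct_eigenvalues_def)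
qed

theorem mainTheorem8:
  fixes n :: nat and \<rho> :: real
  assumes "1 \<le> n"
  shows
    "invertible_mat (bidiag_mat n (- \<rho>)) \<and>
     kms_mat n \<rho> = kms_L n \<rho> * kms_D n \<rho> * transpose_mat (kms_L n \<rho>) \<and>
     det (kms_mat n \<rho>) = (1 - \<rho>\<^sup>2) ^ (n - 1) \<and>
     (\<rho> \<noteq> 1 \<and> \<rho> \<noteq> -1 \<longrightarrow>
        invertible_mat (kms_mat n \<rho>) \<and>
        invertible_mat (kms_D n \<rho>) \<and>
        mat_inv (kms_mat n \<rho>) =
          bidiag_mat n (- \<rho>) * mat_inv (kms_D n \<rho>) * transpose_mat (bidiag_mat n (- \<rho>)) \<and>
        (2 \<le> n \<longrightarrow>
           mat_inv (kms_mat n \<rho>) = (1 / (1 - \<rho>\<^sup>2)) \<cdot>\<^sub>m kms_tridiag n \<rho>)) \<and>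
     (0 \<le> \<rho> \<and> \<rho> \<le> 1 \<longrightarrow> totally_nonneg (kms_mat n \<rho>)) \<and>
     (-1 < \<rho> \<and> \<rho> < 1 \<and> \<rho> \<noteq> 0 \<longrightarrow> has_distinct_eigenvalues (kms_mat n \<rho>))"
proof -
  have sq: "\<rho>\<^sup>2 \<noteq> 1" if "\<rho> \<noteq> 1" "\<rho> \<noteq> -1" using that by (simp add: power2_eq_1_iff)
  have dist: "-1 < \<rho> \<and> \<rho> < 1 \<and> \<rho> \<noteq> 0 \<longrightarrow> has_distinct_eigenvalues (kms_mat n \<rho>)"
    using kms_distinct_eigenvalues[OF assms] by blast
  show ?thesis
    unfolding kms_L_eq
    by (intro conjI impI invertible_bidiag kms_factorization det_kms[OF assms]
        kms_inverse kms_D_inverse(1) kms_inverse_tridiag kms_totally_nonneg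
        dist[rule_format])
      (use sq in auto)
qed

end
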